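(* Let $\mathcal{M}=\langle Q,A,\delta\rangle$ be an MDP with $n=|Q|$ states, let $\alpha$ be the smallest positive probability in the transitions of $\mathcal{M}$, let $T\subseteq Q$, let $d_0$ be an initial distribution with smallest positive probability $\alpha_0$, and let $$\epsilon_w=\alpha_0\cdot\frac{\alpha^{(n+2)\cdot 4^{n}}}{n^{2^{n}+1}},\qquad N_w=2^{n}.$$ If $d_0$ is not almost-sure weakly synchronizing in $T$ (i.e. there is no strategy $\sigma$ such that for every $\epsilon>0$, $\mathcal{M}^{\sigma}_i(T)\ge 1-\epsilon$ for infinitely many $i$), then for every strategy $\sigma$, the strict inequality $\mathcal{M}^{\sigma}_i(T)>1-\epsilon_w$ holds for at most $N_w$ values of $i$.
   Context: An MDP is $\mathcal{M}=\langle Q,A,\delta\rangle$ with $Q$ finite set of states, $A$ finite set of actions, $\delta:Q\times A\to\mathcal{D}(Q)$ probabilistic transition function. A (randomized) strategy is a function $\sigma:(QA)^*Q\to\mathcal{D}(A)$; with initial distribution $d_0$ it induces a probability measure $\Pr^{\sigma}_{d_0}$ on infinite paths in the standard way. $\mathcal{M}^{\sigma}_i(q)=\Pr^{\sigma}_{d_0}(\text{the state at position } i \text{ is } q)$ is the distribution after $i$ steps, $d(T)=\sum_{q\in T}d(q)$, and the smallest positive probability of $d_0$ is $\min\{d_0(q)\mid d_0(q)>0\}$. *)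

theory Defs
  imports "HOL-Probability.Probability"
begin

type_synonym ('q, 'a) mdp = "'q \<Rightarrow> 'a \<Rightarrow> 'q pmf"

text \<open>
  An element of \<open>(QA)\<^sup>*Q\<close> is split into the list of completed state-action pairs
  and the current state.
\<close>

type_synonym ('q, 'a) strategy = "('q \<times> 'a) list \<Rightarrow> 'q \<Rightarrow> 'a pmf"

text \<open>
  An infinite path \<open>q\<^sub>0 a\<^sub>0 q\<^sub>1 a\<^sub>1 \<dots>\<close> is the function \<open>\<omega>\<close> with \<open>\<omega> i = (q\<^sub>i, a\<^sub>i)\<close>. Given the
  pairs at the positions below \<open>i\<close>, \<open>path_step \<dots> i \<omega>\<close> is the conditional law of the pair
  at position \<open>i\<close>.
\<close>

definition path_step ::
  "('q, 'a) mdp \<Rightarrow> ('q, 'a) strategy \<Rightarrow> 'q pmf \<Rightarrow> nat \<Rightarrow> (nat \<Rightarrow> 'q \<times> 'a) \<Rightarrow> ('q \<times> 'a) pmf" where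
  "path_step \<delta> \<sigma> d\<^sub>0 i \<omega> =
     bind_pmf (case i of 0 \<Rightarrow> d\<^sub>0 | Suc j \<Rightarrow> \<delta> (fst (\<omega> j)) (snd (\<omega> j)))
       (\<lambda>q. map_pmf (Pair q) (\<sigma> (map \<omega> [0..<i]) q))"

interpretation path: Ionescu_Tulcea
  "\<lambda>i \<omega>. measure_pmf (path_step \<delta> \<sigma> d\<^sub>0 i \<omega>)"
  "\<lambda>_. count_space (UNIV :: ('q \<times> 'a) set)"
  for \<delta> :: "('q::finite, 'a::finite) mdp" and \<sigma> :: "('q, 'a) strategy" and d\<^sub>0 :: "'q pmf"
proof
  show "(\<lambda>\<omega>. measure_pmf (path_step \<delta> \<sigma> d\<^sub>0 i \<omega>)) \<in>
      measurable (PiM {0..<i} (\<lambda>_. count_space UNIV))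
        (subprob_algebra (count_space (UNIV :: ('q \<times> 'a) set)))" for i
    by (subst count_space_PiM_finite)
       (auto simp: space_subprob_algebra measure_pmf.subprob_space_axioms)
qed

definition path_measure ::
  "('q::finite, 'a::finite) mdp \<Rightarrow> ('q, 'a) strategy \<Rightarrow> 'q pmf \<Rightarrow> (nat \<Rightarrow> 'q \<times> 'a) measure" where
  "path_measure \<delta> \<sigma> d\<^sub>0 = path.PF.lim \<delta> \<sigma> d\<^sub>0"

text \<open>The probabilities of cylinder sets are the usual products.\<close>

lemma pmf_path_step:
  "pmf (path_step \<delta> \<sigma> d\<^sub>0 i \<omega>) (q, a) =
     pmf (case i of 0 \<Rightarrow> d\<^sub>0 | Suc j \<Rightarrow> \<delta> (fst (\<omega> j)) (snd (\<omega> j))) q *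
     pmf (\<sigma> (map \<omega> [0..<i]) q) a"
proof -
  define D where "D = (case i of 0 \<Rightarrow> d\<^sub>0 | Suc j \<Rightarrow> \<delta> (fst (\<omega> j)) (snd (\<omega> j)))"
  have *: "pmf (map_pmf (Pair r) (\<sigma> (map \<omega> [0..<i]) r)) (q, a) =
      pmf (\<sigma> (map \<omega> [0..<i]) q) a * indicator {q} r" for r
  proof (cases "r = q")
    case True
    then show ?thesis
      using pmf_map_inj'[of "Pair q" "\<sigma> (map \<omega> [0..<i]) q" a] by (simp add: inj_def)
  next
    case False
    then show ?thesis
      by (subst pmf_map_outside) auto
  qed
  have "pmf (bind_pmf D (\<lambda>q. map_pmf (Pair q) (\<sigma> (map \<omega> [0..<i]) q))) (q, a) =
      pmf D q * pmf (\<sigma> (map \<omega> [0..<i]) q) a"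
    by (simp add: pmf_bind * measure_pmf_single)
  then show ?thesis
    by (simp add: path_step_def D_def)
qed

lemma path_step_cong:
  "(\<And>j. j < i \<Longrightarrow> \<omega> j = \<omega>' j) \<Longrightarrow> path_step \<delta> \<sigma> d\<^sub>0 i \<omega> = path_step \<delta> \<sigma> d\<^sub>0 i \<omega>'"
proof -
  assume *: "\<And>j. j < i \<Longrightarrow> \<omega> j = \<omega>' j"
  then have "map \<omega> [0..<i] = map \<omega>' [0..<i]" by simp
  moreover have "(case i of 0 \<Rightarrow> d\<^sub>0 | Suc j \<Rightarrow> \<delta> (fst (\<omega> j)) (snd (\<omega> j))) =
      (case i of 0 \<Rightarrow> d\<^sub>0 | Suc j \<Rightarrow> \<delta> (fst (\<omega>' j)) (snd (\<omega>' j)))"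
    using * by (simp split: nat.split)
  ultimately show ?thesis
    unfolding path_step_def by (simp only:)
qed

lemma emeasure_path_cylinder:
  fixes \<delta> :: "('q::finite, 'a::finite) mdp"
  shows "emeasure (path_measure \<delta> \<sigma> d\<^sub>0) {\<omega>. \<forall>i<n. \<omega> i = x i} =
    (\<Prod>i<n. ennreal (pmf (path_step \<delta> \<sigma> d\<^sub>0 i x) (x i)))"
proof -
  let ?M = "\<lambda>_::nat. count_space (UNIV :: ('q \<times> 'a) set)"
  let ?u = "\<lambda>_::nat. undefined :: 'q \<times> 'a"
  have u: "?u \<in> space (PiM {0..<0} ?M)" by (simp add: space_PiM)
  have PiM: "PiM {0..<k} ?M = count_space ({0..<k} \<rightarrow>\<^sub>E UNIV)" for k
    by (rule count_space_PiM_finite) auto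
  have sets: "X \<in> sets (PiM {0..<k} ?M)" if "X \<subseteq> {0..<k} \<rightarrow>\<^sub>E UNIV" for k X
    unfolding PiM using that by simp
  have C: "emeasure (path.C \<delta> \<sigma> d\<^sub>0 0 k ?u) {restrict x {0..<k}} =
      (\<Prod>i<k. ennreal (pmf (path_step \<delta> \<sigma> d\<^sub>0 i x) (x i)))" for k
  proof (induction k)
    case 0
    then show ?case by (simp add: PiM_empty emeasure_return)
  next
    case (Suc k)
    have X: "{restrict x {0..<Suc k}} \<in> sets (PiM {0..<Suc k} ?M)"
      by (rule sets) auto
    have eP: "emeasure (path.eP \<delta> \<sigma> d\<^sub>0 k \<omega>) {restrict x {0..<Suc k}} =
       ennreal (pmf (path_step \<delta> \<sigma> d\<^sub>0 k x) (x k)) * indicator {restrict x {0..<k}} \<omega>"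
      if \<omega>: "\<omega> \<in> space (PiM {0..<k} ?M)" for \<omega>
    proof -
      have ext: "\<omega> \<in> {0..<k} \<rightarrow>\<^sub>E UNIV" using \<omega> by (simp add: space_PiM)
      have *: "(\<lambda>y. fun_upd \<omega> k y) -` {restrict x {0..<Suc k}} =
          (if \<omega> = restrict x {0..<k} then {x k} else {})"
      proof -
        have "fun_upd \<omega> k y = restrict x {0..<Suc k} \<longleftrightarrow>
            \<omega> = restrict x {0..<k} \<and> y = x k" for y
        proof
          assume a: "fun_upd \<omega> k y = restrict x {0..<Suc k}"
          have "\<omega> j = restrict x {0..<k} j" for j
            using fun_cong[OF a, of j] ext by (auto split: if_splits simp: PiE_iff extensional_def)
          moreover have "y = x k" using fun_cong[OF a, of k] by simp
          ultimately show "\<omega> = restrict x {0..<k} \<and> y = x k" by auto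
        qed (auto simp: fun_eq_iff)
        then show ?thesis unfolding vimage_def by (simp only: singleton_iff) auto
      qed
      have "emeasure (path.eP \<delta> \<sigma> d\<^sub>0 k \<omega>) {restrict x {0..<Suc k}} =
          emeasure (measure_pmf (path_step \<delta> \<sigma> d\<^sub>0 k \<omega>))
            ((\<lambda>y. fun_upd \<omega> k y) -` {restrict x {0..<Suc k}} \<inter> space (?M k))"
        by (rule path.emeasure_eP[OF \<omega> X])
      also have "\<dots> = ennreal (pmf (path_step \<delta> \<sigma> d\<^sub>0 k \<omega>) (x k)) * indicator {restrict x {0..<k}} \<omega>"
        by (simp add: * emeasure_pmf_single)
      also have "\<dots> = ennreal (pmf (path_step \<delta> \<sigma> d\<^sub>0 k x) (x k)) * indicator {restrict x {0..<k}} \<omega>"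
        using path_step_cong[of k \<omega> x \<delta> \<sigma> d\<^sub>0] by (auto split: split_indicator)
      finally show ?thesis .
    qed
    have sp: "space (path.C \<delta> \<sigma> d\<^sub>0 0 k ?u) = space (PiM {0..<k} ?M)"
      using path.space_C[OF u, of \<delta> \<sigma> d\<^sub>0 k] by simp
    have se: "sets (path.C \<delta> \<sigma> d\<^sub>0 0 k ?u) = sets (PiM {0..<k} ?M)"
      using path.sets_C[OF u, of \<delta> \<sigma> d\<^sub>0 k] by simp
    have "emeasure (path.C \<delta> \<sigma> d\<^sub>0 0 (Suc k) ?u) {restrict x {0..<Suc k}} =
       (\<integral>\<^sup>+\<omega>. emeasure (path.eP \<delta> \<sigma> d\<^sub>0 k \<omega>) {restrict x {0..<Suc k}} \<partial>path.C \<delta> \<sigma> d\<^sub>0 0 k ?u)"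
      using path.measurable_eP[of \<delta> \<sigma> d\<^sub>0 k]
      by (simp, subst emeasure_bind[OF _ _ X])
         (auto simp: sp space_PiM PiE_eq_empty_iff measurable_cong_sets[OF se refl])
    also have "\<dots> = (\<integral>\<^sup>+\<omega>. ennreal (pmf (path_step \<delta> \<sigma> d\<^sub>0 k x) (x k)) *
        indicator {restrict x {0..<k}} \<omega> \<partial>path.C \<delta> \<sigma> d\<^sub>0 0 k ?u)"
      by (intro nn_integral_cong) (simp add: sp eP)
    also have "\<dots> = ennreal (pmf (path_step \<delta> \<sigma> d\<^sub>0 k x) (x k)) *
        emeasure (path.C \<delta> \<sigma> d\<^sub>0 0 k ?u) {restrict x {0..<k}}"
      by (intro nn_integral_cmult_indicator) (unfold se, rule sets, auto)
    finally show ?case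
      by (simp only: Suc.IH mult.commute prod.lessThan_Suc)
  qed
  have X: "{restrict x {0..<n}} \<in> sets (PiM {0..<n} ?M)" by (rule sets) auto
  have emb: "{\<omega>. \<forall>i<n. \<omega> i = x i} = path.PF.emb UNIV {0..<n} {restrict x {0..<n}}"
    by (auto simp: prod_emb_def space_PiM fun_eq_iff restrict_def) metis
  have emb': "path.PF.emb {0..<n} {0..<n} {restrict x {0..<n}} = {restrict x {0..<n}}"
    by (rule prod_emb_id) auto
  show ?thesis
    unfolding path_measure_def emb
    by (simp add: path.lim X path.emeasure_CI[of "{0..<n}" n] emb' C)
qed

lemma prob_space_path_measure: "prob_space (path_measure \<delta> \<sigma> d\<^sub>0)"
  using emeasure_path_cylinder[of \<delta> \<sigma> d\<^sub>0 0]
  by (intro prob_spaceI) (simp add: path_measure_def space_PiM)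

lemma sets_path_measure:
  "sets (path_measure \<delta> \<sigma> d\<^sub>0) = sets (PiM UNIV (\<lambda>_. count_space UNIV))"
  by (simp add: path_measure_def)

definition state_dist ::
  "('q::finite, 'a::finite) mdp \<Rightarrow> ('q, 'a) strategy \<Rightarrow> 'q pmf \<Rightarrow> nat \<Rightarrow> 'q \<Rightarrow> real" where
  "state_dist \<delta> \<sigma> d\<^sub>0 i q = \<P>(\<omega> in path_measure \<delta> \<sigma> d\<^sub>0. fst (\<omega> i) = q)"

lemma state_event_measurable:
  "{\<omega> \<in> space (path_measure \<delta> \<sigma> d\<^sub>0). fst (\<omega> i) = q} \<in> sets (path_measure \<delta> \<sigma> d\<^sub>0)"
proof -
  have "(\<lambda>\<omega>. fst (\<omega> i)) \<in> measurable (path_measure \<delta> \<sigma> d\<^sub>0) (count_space UNIV)"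
    unfolding measurable_cong_sets[OF sets_path_measure refl]
    by (rule measurable_compose[where g = fst, OF measurable_component_singleton]) auto
  from measurable_sets[OF this, of "{q}"] show ?thesis
    by (simp add: vimage_def Int_def conj_commute)
qed

definition mass :: "('q \<Rightarrow> real) \<Rightarrow> 'q set \<Rightarrow> real" where
  "mass d T = (\<Sum>q\<in>T. d q)"

definition almost_sure_weakly_sync ::
  "('q::finite, 'a::finite) mdp \<Rightarrow> 'q pmf \<Rightarrow> 'q set \<Rightarrow> bool" where
  "almost_sure_weakly_sync \<delta> d\<^sub>0 T \<longleftrightarrow>
     (\<exists>\<sigma>. \<forall>\<epsilon>>0. \<exists>\<^sub>\<infinity>i. mass (state_dist \<delta> \<sigma> d\<^sub>0 i) T \<ge> 1 - \<epsilon>)"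

definition min_init_prob :: "'q pmf \<Rightarrow> real" where
  "min_init_prob d\<^sub>0 = Min {pmf d\<^sub>0 q | q. pmf d\<^sub>0 q > 0}"

definition min_trans_prob :: "('q, 'a) mdp \<Rightarrow> real" where
  "min_trans_prob \<delta> = Min {pmf (\<delta> q a) q' | q a q'. pmf (\<delta> q a) q' > 0}"

end

theory Submission
  imports Defs
begin

text \<open>
  Suppose that the mass in \<open>T\<close> exceeds \<open>1 - \<epsilon>\<^sub>w\<close> at \<open>2\<^sup>n + 1\<close> instants, and cut the support at the
  \<open>m\<close>-th of them at a threshold \<open>\<theta> m\<close> that decreases geometrically in \<open>m\<close>. Two of the resulting
  subsets of \<open>T\<close> coincide; call this set \<open>S\<close> and let \<open>p\<close> be the delay between the two instants.
  Then from every state of \<open>S\<close> one is back in \<open>S\<close> after \<open>p\<close> steps with tiny error, and \<open>S\<close> is also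
  reached from \<open>d\<^sub>0\<close> with tiny error.

  The sure predecessors \<open>pre S i\<close> are periodic from some \<open>k\<close> on, with some period \<open>r\<close>. Removing from
  all pairs (state, remaining time modulo \<open>r\<close>) those from which \<open>pre S k\<close> cannot be reached
  without risking to leave the current set yields a region \<open>V\<close>; each round costs at most a
  factor \<open>\<alpha>\<close> in the error, so a pair whose error is below \<open>\<alpha> ^ (k + n * r)\<close> survives. Inside \<open>V\<close> a
  strategy that never leaves \<open>V\<close> has an error tending to \<open>0\<close> with the remaining time. If \<open>r\<close> divides
  the length of the rounds, states that missed \<open>S\<close> are in \<open>V\<close> again at the end of a round, so
  longer and longer rounds can be concatenated into one almost-sure strategy.
\<close>

subsection \<open>State distributions as finite sums\<close>

context
  fixes \<delta> :: "('q::finite, 'a::finite) mdp" and \<sigma> :: "('q, 'a) strategy" and d\<^sub>0 :: "'q pmf"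
begin

interpretation P: prob_space "path_measure \<delta> \<sigma> d\<^sub>0"
  by (rule prob_space_path_measure)

lemma space_path_measure: "space (path_measure \<delta> \<sigma> d\<^sub>0) = UNIV"
  using sets_eq_imp_space_eq[OF sets_path_measure, of \<delta> \<sigma> d\<^sub>0] by (simp add: space_PiM)

lemma component_event_measurable: "{\<omega>. Q (\<omega> i)} \<in> sets (path_measure \<delta> \<sigma> d\<^sub>0)"
proof -
  have "(\<lambda>\<omega>. \<omega> i) \<in> measurable (path_measure \<delta> \<sigma> d\<^sub>0) (count_space UNIV)"
    unfolding measurable_cong_sets[OF sets_path_measure refl]
    by (rule measurable_component_singleton) auto
  from measurable_sets[OF this, of "{z. Q z}"] show ?thesis
    by (simp add: vimage_def space_path_measure)
qed

lemma cylinder_measurable: "{\<omega>. \<forall>i<n. \<omega> i = x i} \<in> sets (path_measure \<delta> \<sigma> d\<^sub>0)"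
proof -
  have "{\<omega> \<in> space (path_measure \<delta> \<sigma> d\<^sub>0). \<forall>i\<in>{..<n}. \<omega> i = x i} \<in> sets (path_measure \<delta> \<sigma> d\<^sub>0)"
    by (intro sets.sets_Collect_finite_All) (use component_event_measurable[where Q = "\<lambda>z. z = x _"] in \<open>auto simp: space_path_measure\<close>)
  then show ?thesis by (simp add: space_path_measure Ball_def)
qed

lemma measure_path_cylinder:
  "measure (path_measure \<delta> \<sigma> d\<^sub>0) {\<omega>. \<forall>i<n. \<omega> i = x i} =
    (\<Prod>i<n. pmf (path_step \<delta> \<sigma> d\<^sub>0 i x) (x i))"
  using emeasure_path_cylinder[of \<delta> \<sigma> d\<^sub>0 n x]
  by (simp add: P.emeasure_eq_measure prod_ennreal prod_nonneg)

lemma measure_path_cylinder_Int: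
  "measure (path_measure \<delta> \<sigma> d\<^sub>0) ({\<omega>. \<forall>j<i. \<omega> j = x j} \<inter> {\<omega>. \<omega> i = z}) =
    measure (path_measure \<delta> \<sigma> d\<^sub>0) {\<omega>. \<forall>j<i. \<omega> j = x j} * pmf (path_step \<delta> \<sigma> d\<^sub>0 i x) z"
proof -
  have "{\<omega>. \<forall>j<i. \<omega> j = x j} \<inter> {\<omega>. \<omega> i = z} = {\<omega>. \<forall>j<Suc i. \<omega> j = (x(i := z)) j}"
    by (auto simp: less_Suc_eq)
  moreover have "path_step \<delta> \<sigma> d\<^sub>0 j (x(i := z)) = path_step \<delta> \<sigma> d\<^sub>0 j x" if "j \<le> i" for j
    using that by (intro path_step_cong) auto
  ultimately show ?thesis
    by (simp only: measure_path_cylinder prod.lessThan_Suc) (simp del: fun_upd_apply, simp)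
qed

lemma measure_path_split:
  assumes E: "E \<in> sets (path_measure \<delta> \<sigma> d\<^sub>0)"
  shows "measure (path_measure \<delta> \<sigma> d\<^sub>0) E =
    (\<Sum>x\<in>{..<n} \<rightarrow>\<^sub>E UNIV. measure (path_measure \<delta> \<sigma> d\<^sub>0) ({\<omega>. \<forall>i<n. \<omega> i = x i} \<inter> E))"
proof -
  let ?I = "{..<n} \<rightarrow>\<^sub>E (UNIV :: ('q \<times> 'a) set)"
  have "E = (\<Union>x\<in>?I. {\<omega>. \<forall>i<n. \<omega> i = x i} \<inter> E)"
  proof (intro equalityI subsetI)
    fix \<omega> assume "\<omega> \<in> E"
    then show "\<omega> \<in> (\<Union>x\<in>?I. {\<omega>. \<forall>i<n. \<omega> i = x i} \<inter> E)"
      by (intro UN_I[of "restrict \<omega> {..<n}"]) auto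
  qed auto
  moreover have "disjoint_family_on (\<lambda>x. {\<omega>. \<forall>i<n. \<omega> i = x i} \<inter> E) ?I"
  proof (unfold disjoint_family_on_def, intro ballI impI, rule ccontr)
    fix x y assume xy: "x \<in> ?I" "y \<in> ?I" "x \<noteq> y"
      and "({\<omega>. \<forall>i<n. \<omega> i = x i} \<inter> E) \<inter> ({\<omega>. \<forall>i<n. \<omega> i = y i} \<inter> E) \<noteq> {}"
    then have "x i = y i" for i
      by (cases "i < n") (auto simp: PiE_iff extensional_def)
    with xy show False by blast
  qed
  moreover have "finite ?I" by (intro finite_PiE) auto
  moreover have "(\<lambda>x. {\<omega>. \<forall>i<n. \<omega> i = x i} \<inter> E) ` ?I \<subseteq> sets (path_measure \<delta> \<sigma> d\<^sub>0)"
    using E cylinder_measurable by auto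
  ultimately show ?thesis
    using P.finite_measure_finite_Union[of ?I "\<lambda>x. {\<omega>. \<forall>i<n. \<omega> i = x i} \<inter> E"] by simp
qed

text \<open>Actions depend on the whole history, so the state distributions alone satisfy no
  recursion; the joint law of state and action determines the next state distribution.\<close>

definition joint_dist :: "nat \<Rightarrow> 'q \<Rightarrow> 'a \<Rightarrow> real" where
  "joint_dist i q a = measure (path_measure \<delta> \<sigma> d\<^sub>0) {\<omega>. \<omega> i = (q, a)}"

lemma joint_dist_nonneg: "joint_dist i q a \<ge> 0"
  by (simp add: joint_dist_def)

lemma joint_dist_eq_sum:
  "joint_dist i q a = (\<Sum>x\<in>{..<i} \<rightarrow>\<^sub>E UNIV.
     measure (path_measure \<delta> \<sigma> d\<^sub>0) {\<omega>. \<forall>j<i. \<omega> j = x j} * pmf (path_step \<delta> \<sigma> d\<^sub>0 i x) (q, a))"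
  unfolding joint_dist_def
  by (subst measure_path_split[of _ i])
     (auto intro: component_event_measurable simp only: measure_path_cylinder_Int)

lemma state_dist_eq_measure: "state_dist \<delta> \<sigma> d\<^sub>0 i q = measure (path_measure \<delta> \<sigma> d\<^sub>0) {\<omega>. fst (\<omega> i) = q}"
  by (simp add: state_dist_def space_path_measure)

lemma state_dist_eq_sum_joint: "state_dist \<delta> \<sigma> d\<^sub>0 i q = (\<Sum>a\<in>UNIV. joint_dist i q a)"
proof -
  have "{\<omega> :: nat \<Rightarrow> 'q \<times> 'a. fst (\<omega> i) = q} = (\<Union>a. {\<omega>. \<omega> i = (q, a)})"
    by (auto simp: prod_eq_iff)
  moreover have "range (\<lambda>a. {\<omega>. \<omega> i = (q, a)}) \<subseteq> sets (path_measure \<delta> \<sigma> d\<^sub>0)"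
    using component_event_measurable[where Q = "\<lambda>z. z = (q, _)"] by auto
  moreover have "disjoint_family_on (\<lambda>a. {\<omega> :: nat \<Rightarrow> 'q \<times> 'a. \<omega> i = (q, a)}) UNIV"
    by (auto simp: disjoint_family_on_def)
  ultimately show ?thesis
    unfolding state_dist_eq_measure joint_dist_def
    using P.finite_measure_finite_Union[of UNIV "\<lambda>a. {\<omega>. \<omega> i = (q, a)}"]
    by simp
qed

lemma state_dist_nonneg: "state_dist \<delta> \<sigma> d\<^sub>0 i q \<ge> 0"
  by (simp add: state_dist_def)

lemma sum_state_dist: "(\<Sum>q\<in>UNIV. state_dist \<delta> \<sigma> d\<^sub>0 i q) = 1"
proof -
  have "(\<Union>q. {\<omega> :: nat \<Rightarrow> 'q \<times> 'a. fst (\<omega> i) = q}) = UNIV" by auto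
  then have "1 = measure (path_measure \<delta> \<sigma> d\<^sub>0) (\<Union>q. {\<omega>. fst (\<omega> i) = q})"
    using P.prob_space by (simp add: space_path_measure)
  also have "\<dots> = (\<Sum>q\<in>UNIV. state_dist \<delta> \<sigma> d\<^sub>0 i q)"
    unfolding state_dist_eq_measure
    by (intro P.finite_measure_finite_Union)
       (auto simp: disjoint_family_on_def intro: component_event_measurable)
  finally show ?thesis by simp
qed

lemma state_dist_0: "state_dist \<delta> \<sigma> d\<^sub>0 0 q = pmf d\<^sub>0 q"
proof -
  have "joint_dist 0 q a = pmf d\<^sub>0 q * pmf (\<sigma> [] q) a" for a
    using P.prob_space by (simp add: joint_dist_eq_sum pmf_path_step space_path_measure)
  moreover have "(\<Sum>a\<in>UNIV. pmf (\<sigma> [] q) a) = 1"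
    by (rule sum_pmf_eq_1) auto
  ultimately show ?thesis
    by (simp add: state_dist_eq_sum_joint sum_distrib_left[symmetric])
qed

lemma state_dist_Suc:
  "state_dist \<delta> \<sigma> d\<^sub>0 (Suc i) q' = (\<Sum>q\<in>UNIV. \<Sum>a\<in>UNIV. joint_dist i q a * pmf (\<delta> q a) q')"
proof -
  let ?I = "{..<Suc i} \<rightarrow>\<^sub>E (UNIV :: ('q \<times> 'a) set)"
  define c where "c x = measure (path_measure \<delta> \<sigma> d\<^sub>0) {\<omega>. \<forall>j<Suc i. \<omega> j = x j}" for x
  have "state_dist \<delta> \<sigma> d\<^sub>0 (Suc i) q' =
      (\<Sum>a\<in>UNIV. \<Sum>x\<in>?I. c x * (pmf (\<delta> (fst (x i)) (snd (x i))) q' * pmf (\<sigma> (map x [0..<Suc i]) q') a))"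
    by (simp only: state_dist_eq_sum_joint joint_dist_eq_sum pmf_path_step c_def nat.case)
  also have "\<dots> = (\<Sum>x\<in>?I. \<Sum>a\<in>UNIV.
      c x * pmf (\<delta> (fst (x i)) (snd (x i))) q' * pmf (\<sigma> (map x [0..<Suc i]) q') a)"
    by (subst sum.swap) (simp only: mult.assoc)
  also have "\<dots> = (\<Sum>x\<in>?I. c x * pmf (\<delta> (fst (x i)) (snd (x i))) q')"
    by (simp only: sum_distrib_left[symmetric] sum_pmf_eq_1[OF finite subset_UNIV] mult_1_right)
  \<comment> \<open>The inserted sum over \<open>z\<close> groups the prefixes by their last pair,
    on which alone the next state depends.\<close>
  also have "\<dots> = (\<Sum>x\<in>?I. \<Sum>z\<in>UNIV. (if z = x i then c x else 0) * pmf (\<delta> (fst z) (snd z)) q')"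
    by (intro sum.cong refl) (simp add: if_distrib[of "\<lambda>y. y * _"] cong: if_cong)
  also have "\<dots> = (\<Sum>z\<in>UNIV. (\<Sum>x\<in>?I. if z = x i then c x else 0) * pmf (\<delta> (fst z) (snd z)) q')"
    by (subst sum.swap) (simp only: sum_distrib_right)
  also have "\<dots> = (\<Sum>z\<in>UNIV. joint_dist i (fst z) (snd z) * pmf (\<delta> (fst z) (snd z)) q')"
  proof (intro sum.cong refl arg_cong2[of _ _ _ _ "(*)"])
    fix z
    have "{\<omega>. \<forall>j<Suc i. \<omega> j = x j} \<inter> {\<omega>. \<omega> i = z} =
        (if z = x i then {\<omega>. \<forall>j<Suc i. \<omega> j = x j} else {})" for x :: "nat \<Rightarrow> 'q \<times> 'a"
      by auto
    then show "(\<Sum>x\<in>?I. if z = x i then c x else 0) = joint_dist i (fst z) (snd z)"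
      unfolding joint_dist_def c_def prod.collapse
      by (subst measure_path_split[of "{\<omega>. \<omega> i = z}" "Suc i"])
         (auto intro!: component_event_measurable sum.cong)
  qed
  finally show ?thesis
    by (simp add: sum.cartesian_product case_prod_unfold)
qed

end

text \<open>The synchronizing strategy built later is deterministic and sees only the time and the
  current state, so its state distributions form a Markov chain.\<close>

lemma state_dist_Suc_markov:
  fixes \<delta> :: "('q::finite, 'a::finite) mdp"
  assumes "\<sigma> = (\<lambda>h q. return_pmf (\<tau> (length h) q))"
  shows "state_dist \<delta> \<sigma> d\<^sub>0 (Suc i) q' = (\<Sum>q\<in>UNIV. state_dist \<delta> \<sigma> d\<^sub>0 i q * pmf (\<delta> q (\<tau> i q)) q')"
proof -
  have "joint_dist \<delta> \<sigma> d\<^sub>0 i q a = 0" if "a \<noteq> \<tau> i q" for q a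
    using that by (simp add: joint_dist_eq_sum pmf_path_step assms)
  then have J: "joint_dist \<delta> \<sigma> d\<^sub>0 i q a = (if a = \<tau> i q then joint_dist \<delta> \<sigma> d\<^sub>0 i q (\<tau> i q) else 0)" for q a
    by simp
  have "state_dist \<delta> \<sigma> d\<^sub>0 i q = joint_dist \<delta> \<sigma> d\<^sub>0 i q (\<tau> i q)" for q
  proof -
    have "state_dist \<delta> \<sigma> d\<^sub>0 i q =
        (\<Sum>a\<in>UNIV. if a = \<tau> i q then joint_dist \<delta> \<sigma> d\<^sub>0 i q (\<tau> i q) else 0)"
      unfolding state_dist_eq_sum_joint by (intro sum.cong refl) (rule J)
    then show ?thesis by simp
  qed
  moreover have "(\<Sum>a\<in>UNIV. joint_dist \<delta> \<sigma> d\<^sub>0 i q a * pmf (\<delta> q a) q') =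
      joint_dist \<delta> \<sigma> d\<^sub>0 i q (\<tau> i q) * pmf (\<delta> q (\<tau> i q)) q'" for q
    by (subst J) (simp add: if_distrib[of "\<lambda>y. y * _"] cong: if_cong)
  ultimately show ?thesis by (simp add: state_dist_Suc)
qed

subsection \<open>Expectations along a transition\<close>

locale bounded_mdp =
  fixes \<delta> :: "('q::finite, 'a::finite) mdp" and \<alpha> :: real
  assumes \<alpha>_pos: "0 < \<alpha>"
    and \<alpha>_le: "0 < pmf (\<delta> q a) q' \<Longrightarrow> \<alpha> \<le> pmf (\<delta> q a) q'"
begin

lemma \<alpha>_le_1: "\<alpha> \<le> 1"
proof -
  obtain q' where "q' \<in> set_pmf (\<delta> undefined undefined)"
    using set_pmf_not_empty by fast
  then have "\<alpha> \<le> pmf (\<delta> undefined undefined) q'"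
    by (intro \<alpha>_le) (simp add: pmf_positive)
  then show ?thesis using pmf_le_1 by (rule order_trans)
qed

lemma \<alpha>_power_antimono: "m \<le> n \<Longrightarrow> \<alpha> ^ n \<le> \<alpha> ^ m"
  using \<alpha>_pos \<alpha>_le_1 by (intro power_decreasing) auto

lemma \<alpha>_power_le_1: "\<alpha> ^ n \<le> 1"
  using \<alpha>_pos \<alpha>_le_1 by (intro power_le_one) auto

definition ev :: "'q \<Rightarrow> 'a \<Rightarrow> ('q \<Rightarrow> real) \<Rightarrow> real" where
  "ev q a f = (\<Sum>q'\<in>UNIV. pmf (\<delta> q a) q' * f q')"

lemma ev_const: "ev q a (\<lambda>_. c) = c"
  by (simp add: ev_def sum_distrib_right[symmetric] sum_pmf_eq_1)

lemma ev_add: "ev q a (\<lambda>q'. f q' + g q') = ev q a f + ev q a g"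
  by (simp add: ev_def distrib_left sum.distrib)

lemma ev_cmult: "ev q a (\<lambda>q'. c * f q') = c * ev q a f"
  by (simp add: ev_def sum_distrib_left algebra_simps)

lemma ev_mono:
  assumes "\<And>q'. q' \<in> set_pmf (\<delta> q a) \<Longrightarrow> f q' \<le> g q'"
  shows "ev q a f \<le> ev q a g"
  unfolding ev_def
proof (rule sum_mono)
  fix q' show "pmf (\<delta> q a) q' * f q' \<le> pmf (\<delta> q a) q' * g q'"
    using assms[of q'] by (cases "q' \<in> set_pmf (\<delta> q a)") (auto simp: set_pmf_iff mult_left_mono)
qed

lemma ev_le: "(\<And>q'. q' \<in> set_pmf (\<delta> q a) \<Longrightarrow> f q' \<le> c) \<Longrightarrow> ev q a f \<le> c"
  using ev_mono[of q a f "\<lambda>_. c"] by (simp add: ev_const)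

lemma ev_ge: "(\<And>q'. q' \<in> set_pmf (\<delta> q a) \<Longrightarrow> c \<le> f q') \<Longrightarrow> c \<le> ev q a f"
  using ev_mono[of q a "\<lambda>_. c" f] by (simp add: ev_const)

lemma ev_ge_single:
  assumes "q' \<in> set_pmf (\<delta> q a)" "\<And>q'. q' \<in> set_pmf (\<delta> q a) \<Longrightarrow> 0 \<le> f q'"
  shows "\<alpha> * f q' \<le> ev q a f"
proof -
  have "\<alpha> * f q' \<le> pmf (\<delta> q a) q' * f q'"
    using assms \<alpha>_le[of q a q'] by (intro mult_right_mono) (auto simp: pmf_positive)
  also have "\<dots> \<le> ev q a f"
    unfolding ev_def
  proof (rule member_le_sum)
    fix x show "0 \<le> pmf (\<delta> q a) x * f x"
      using assms(2)[of x] by (cases "x \<in> set_pmf (\<delta> q a)") (auto simp: set_pmf_iff)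
  qed auto
  finally show ?thesis .
qed

text \<open>Dual of \<open>ev_ge_single\<close>, applied to \<open>c - f\<close>.\<close>

lemma ev_le_single:
  assumes "q' \<in> set_pmf (\<delta> q a)" "\<And>q'. q' \<in> set_pmf (\<delta> q a) \<Longrightarrow> f q' \<le> c" "f q' \<le> c - b"
    "0 \<le> b"
  shows "ev q a f \<le> c - \<alpha> * b"
proof -
  have "\<alpha> * b \<le> \<alpha> * (c - f q')" using assms \<alpha>_pos by (intro mult_left_mono) auto
  also have "\<dots> \<le> ev q a (\<lambda>q'. c + -1 * f q')"
    using ev_ge_single[of q' q a "\<lambda>q'. c + -1 * f q'"] assms by simp
  also have "\<dots> = c - ev q a f"
    by (simp only: ev_add ev_cmult ev_const)
  finally show ?thesis by simp
qed

subsection \<open>Optimal values and sure predecessors\<close>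

text \<open>
  \<open>val S j q\<close> is the least probability with which a strategy started in \<open>q\<close> is outside
  \<open>S\<close> after \<open>j\<close> steps, and \<open>pre S j\<close> is the set where this probability vanishes.
\<close>

primrec val :: "'q set \<Rightarrow> nat \<Rightarrow> 'q \<Rightarrow> real" where
  "val S 0 q = indicator (- S) q"
| "val S (Suc j) q = Min (range (\<lambda>a. ev q a (val S j)))"

primrec pre :: "'q set \<Rightarrow> nat \<Rightarrow> 'q set" where
  "pre S 0 = S"
| "pre S (Suc j) = {q. \<exists>a. set_pmf (\<delta> q a) \<subseteq> pre S j}"

lemma val_Suc_le: "val S (Suc j) q \<le> ev q a (val S j)"
  by simp

lemma val_Suc_ge: "(\<And>a. c \<le> ev q a (val S j)) \<Longrightarrow> c \<le> val S (Suc j) q"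
  by simp

lemma val_Suc_attained: obtains a where "val S (Suc j) q = ev q a (val S j)"
proof -
  have "val S (Suc j) q \<in> range (\<lambda>a. ev q a (val S j))"
    unfolding val.simps by (rule Min_in) auto
  then show thesis using that unfolding val.simps by blast
qed

lemma val_nonneg: "0 \<le> val S j q"
proof (induction j arbitrary: q)
  case (Suc j)
  show ?case by (intro val_Suc_ge ev_ge Suc.IH)
qed simp

lemma val_le_1: "val S j q \<le> 1"
proof (induction j arbitrary: q)
  case (Suc j)
  show ?case using val_Suc_le ev_le[OF Suc.IH] by (rule order_trans)
qed (simp add: indicator_def)

text \<open>Every action risks a successor outside the next predecessor set with probability at
  least \<alpha>, one factor per step. Hence values below \<open>\<alpha> ^ j\<close>
  vanish.\<close>

lemma val_ge_outside_pre: "q \<notin> pre S j \<Longrightarrow> \<alpha> ^ j \<le> val S j q"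
proof (induction j arbitrary: q)
  case (Suc j)
  show ?case
  proof (rule val_Suc_ge)
    fix a
    obtain q' where q': "q' \<in> set_pmf (\<delta> q a)" "q' \<notin> pre S j" using Suc.prems by auto
    have "\<alpha> ^ Suc j \<le> \<alpha> * val S j q'" using Suc.IH[OF q'(2)] \<alpha>_pos by simp
    also have "\<dots> \<le> ev q a (val S j)" by (intro ev_ge_single q' val_nonneg)
    finally show "\<alpha> ^ Suc j \<le> ev q a (val S j)" .
  qed
qed simp

lemma val_pre: "q \<in> pre S j \<Longrightarrow> val S j q = 0"
proof (induction j arbitrary: q)
  case (Suc j)
  then obtain a where a: "set_pmf (\<delta> q a) \<subseteq> pre S j" by auto
  have "val S (Suc j) q \<le> ev q a (val S j)" by (rule val_Suc_le)
  also have "\<dots> \<le> 0" using a Suc.IH by (intro ev_le) auto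
  finally show ?case using val_nonneg[of S "Suc j" q] by (rule antisym)
qed simp

lemma pre_mono: "S \<subseteq> S' \<Longrightarrow> pre S j \<subseteq> pre S' j"
  by (induction j) auto

lemma pre_add: "pre S (i + j) = pre (pre S i) j"
  by (induction j) auto

lemma pre_mult:
  assumes "S \<subseteq> pre S p"
  shows "S \<subseteq> pre S (a * p)"
proof (induction a)
  case (Suc a)
  have "pre S p \<subseteq> pre (pre S (a * p)) p" by (intro pre_mono Suc.IH)
  with assms show ?case by (metis pre_add mult_Suc add.commute order_trans)
qed simp

text \<open>An optimal strategy for \<open>i\<close> steps is followed by one for \<open>j\<close>
  steps. Errors add up: a landing outside \<open>S\<close> is charged the trivial bound 1.\<close>

lemma val_add:
  assumes "\<And>q. q \<in> S \<Longrightarrow> val S j q \<le> \<eta>" "0 \<le> \<eta>"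
  shows "val S (j + i) q \<le> \<eta> + val S i q"
proof (induction i arbitrary: q)
  case 0
  show ?case
    using assms(1)[of q] assms(2) val_le_1[of S j q] by (cases "q \<in> S") auto
next
  case (Suc i)
  obtain a where a: "val S (Suc i) q = ev q a (val S i)" by (rule val_Suc_attained)
  have "val S (Suc (j + i)) q \<le> ev q a (val S (j + i))" by (rule val_Suc_le)
  also have "\<dots> \<le> ev q a (\<lambda>q'. \<eta> + val S i q')" by (intro ev_mono Suc.IH)
  also have "\<dots> = \<eta> + val S (Suc i) q" by (simp only: ev_add ev_const a)
  finally show ?case by (simp only: add_Suc_right)
qed

lemma val_mult:
  assumes "\<And>q. q \<in> S \<Longrightarrow> val S p q \<le> \<eta>" "0 \<le> \<eta>" "q \<in> S"
  shows "val S (a * p) q \<le> real a * \<eta>"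
  using assms(3)
proof (induction a arbitrary: q)
  case (Suc a)
  have "val S (p + a * p) q \<le> \<eta> + val S (a * p) q" by (intro val_add assms)
  with Suc show ?case by (fastforce simp: algebra_simps)
qed simp

text \<open>By \<open>pre_add\<close> the sets \<open>pre S i\<close> are the orbit of a self-map of
  the subsets, so two of the first \<open>2 ^ CARD('q) + 1\<close> agree; the later index is
  \<open>k + r\<close>.\<close>

lemma pre_eventually_periodic:
  obtains k r where "k + r \<le> 2 ^ CARD('q)" "0 < r" "\<And>i. k \<le> i \<Longrightarrow> pre S (i + r) = pre S i"
proof -
  have "card (pre S ` {..2 ^ CARD('q)}) \<le> card (UNIV :: 'q set set)"
    by (intro card_mono) auto
  also have "\<dots> < card {..2 ^ CARD('q) :: nat}"
    using card_Pow[of "UNIV :: 'q set"] by simp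
  finally have "\<not> inj_on (pre S) {..2 ^ CARD('q)}" by (rule pigeonhole)
  then obtain i j where "i < j" "j \<le> 2 ^ CARD('q)" "pre S i = pre S j"
    unfolding inj_on_def by (metis atMost_iff linorder_neqE_nat)
  then have eq: "pre S (i + (j - i)) = pre S i" and "0 < j - i" "i + (j - i) \<le> 2 ^ CARD('q)"
    by auto
  moreover have "pre S (l + (j - i)) = pre S l" if "i \<le> l" for l
  proof -
    have "pre S (i + (j - i) + (l - i)) = pre S (i + (l - i))"
      by (subst pre_add) (simp only: eq, simp only: pre_add)
    with that show ?thesis by (simp add: algebra_simps)
  qed
  ultimately show thesis using that by blast
qed

end

subsection \<open>The gap between small and vanishing values\<close>

locale periodic_target = bounded_mdp \<delta> \<alpha>
  for \<delta> :: "('q::finite, 'a::finite) mdp" and \<alpha> :: real +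
  fixes S :: "'q set" and k r :: nat
  assumes r_pos: "0 < r"
    and pre_periodic: "k \<le> i \<Longrightarrow> pre S (i + r) = pre S i"
begin

lemma pre_periodic_mult: "k \<le> i \<Longrightarrow> pre S (i + t * r) = pre S i"
proof (induction t)
  case (Suc t)
  then show ?case using pre_periodic[of "i + t * r"] by (simp add: algebra_simps)
qed simp

text \<open>
  A set \<open>X\<close> of pairs \<open>(q, i mod r)\<close> prescribes the states allowed when \<open>i\<close> steps remain.
  \<open>prog X q i\<close>: from \<open>q\<close>, with \<open>i\<close> steps to go, the set \<open>pre S l\<close> with \<open>l \<ge> k\<close> steps to go is
  reached with positive probability while \<open>X\<close> is surely not left before.
\<close>

inductive prog :: "('q \<times> nat) set \<Rightarrow> 'q \<Rightarrow> nat \<Rightarrow> bool" for X where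
  prog_pre: "k \<le> i \<Longrightarrow> q \<in> pre S i \<Longrightarrow> prog X q i"
| prog_step: "(\<And>q'. q' \<in> set_pmf (\<delta> q a) \<Longrightarrow> (q', i mod r) \<in> X) \<Longrightarrow>
    q'' \<in> set_pmf (\<delta> q a) \<Longrightarrow> prog X q'' i \<Longrightarrow> prog X q (Suc i)"

lemma prog_ge: "prog X q i \<Longrightarrow> k \<le> i"
  by (induction rule: prog.induct) auto

lemma prog_shift: "prog X q i \<Longrightarrow> prog X q (i + t * r)"
proof (induction rule: prog.induct)
  case (prog_pre i q)
  then show ?case by (intro prog.prog_pre) (auto simp: pre_periodic_mult)
next
  case (prog_step q a i q'')
  then have "prog X q (Suc (i + t * r))" by (intro prog.prog_step[of q a _ _ q'']) auto
  then show ?case by simp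
qed

text \<open>The fixed points of the pruning. Any \<open>i'\<close> in the residue class may witness
  progress, since \<open>prog_shift\<close> can raise it by multiples of \<open>r\<close>.\<close>

definition good :: "('q \<times> nat) set \<Rightarrow> bool" where
  "good X \<longleftrightarrow> (\<forall>q i. (q, i mod r) \<in> X \<longrightarrow> (\<exists>i'. i' mod r = i mod r \<and> prog X q i'))"

text \<open>One round of pruning costs one factor \<alpha>: from a pair of \<open>X\<close> without
  progress, an action either risks leaving \<open>X\<close> at once, or has only successors in
  \<open>X\<close> that cannot progress either, and the induction continues.\<close>

lemma val_ge_outside_prog:
  assumes X: "\<And>q i. k \<le> i \<Longrightarrow> (q, i mod r) \<notin> X \<Longrightarrow> \<alpha> ^ (k + m) \<le> val S i q"
    and i: "k \<le> i" and noprog: "\<not> ((q, i mod r) \<in> X \<and> (\<exists>i'. i' mod r = i mod r \<and> prog X q i'))"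
  shows "\<alpha> ^ (k + Suc m) \<le> val S i q"
  using i noprog
proof (induction i arbitrary: q rule: nat_induct_at_least)
  case base
  show ?case
  proof (cases "(q, k mod r) \<in> X")
    case True
    with base have "q \<notin> pre S k" using prog_pre[of k q X] by blast
    then have "\<alpha> ^ k \<le> val S k q" by (rule val_ge_outside_pre)
    with \<alpha>_power_antimono[of k "k + Suc m"] show ?thesis by linarith
  next
    case False
    with X[of k q] \<alpha>_power_antimono[of "k + m" "k + Suc m"] show ?thesis by simp
  qed
next
  case (Suc i)
  show ?case
  proof (cases "(q, Suc i mod r) \<in> X")
    case False
    with X[of "Suc i" q] \<alpha>_power_antimono[of "k + m" "k + Suc m"] Suc.hyps show ?thesis
      by (simp del: val.simps)
  next
    case True
    show ?thesis
    proof (rule val_Suc_ge)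
      fix a
      show "\<alpha> ^ (k + Suc m) \<le> ev q a (val S i)"
      proof (cases "\<exists>q'\<in>set_pmf (\<delta> q a). (q', i mod r) \<notin> X")
        case True
        then obtain q' where q': "q' \<in> set_pmf (\<delta> q a)" "(q', i mod r) \<notin> X" by auto
        have "\<alpha> * \<alpha> ^ (k + m) \<le> \<alpha> * val S i q'"
          using \<alpha>_pos X[OF Suc.hyps q'(2)] by simp
        also have "\<dots> \<le> ev q a (val S i)" by (intro ev_ge_single q' val_nonneg)
        finally show ?thesis by simp
      next
        case False
        have "\<not> prog X q' i'" if "q' \<in> set_pmf (\<delta> q a)" "i' mod r = i mod r" for q' i'
        proof
          assume "prog X q' i'"
          with that False have "prog X q (Suc i')" by (intro prog_step[of q a i' X q']) auto
          moreover have "Suc i' mod r = Suc i mod r" using that(2) by (metis mod_Suc_eq)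
          ultimately show False using Suc.prems True by blast
        qed
        then show ?thesis by (intro ev_ge Suc.IH) auto
      qed
    qed
  qed
qed

text \<open>Each round removes at least one pair, so the number \<open>m\<close> of rounds done plus
  the number of pairs left never exceeds \<open>N\<close>.\<close>

lemma good_subset:
  fixes X :: "('q \<times> nat) set"
  assumes "finite X" "m + card X \<le> N"
    and "\<And>q i. k \<le> i \<Longrightarrow> (q, i mod r) \<notin> X \<Longrightarrow> \<alpha> ^ (k + m) \<le> val S i q"
  shows "\<exists>V. good V \<and> (\<forall>q i. k \<le> i \<longrightarrow> (q, i mod r) \<notin> V \<longrightarrow> \<alpha> ^ (k + N) \<le> val S i q)"
  using assms
proof (induction X arbitrary: m rule: finite_psubset_induct)
  case (psubset X)
  show ?case
  proof (cases "good X")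
    case True
    have "\<alpha> ^ (k + N) \<le> \<alpha> ^ (k + m)" using psubset.prems(1) by (intro \<alpha>_power_antimono) auto
    with True psubset.prems(2) show ?thesis by (meson order_trans)
  next
    case False
    define X' where "X' = {(q, c) \<in> X. \<exists>i'. i' mod r = c \<and> prog X q i'}"
    from False obtain q i where "(q, i mod r) \<in> X" "\<not> (\<exists>i'. i' mod r = i mod r \<and> prog X q i')"
      unfolding good_def by blast
    then have "(q, i mod r) \<in> X - X'" by (auto simp: X'_def)
    moreover have "X' \<subseteq> X" by (auto simp: X'_def)
    ultimately have "X' \<subset> X" by blast
    moreover from this have "card X' < card X" by (intro psubset_card_mono psubset.hyps)
    with psubset.prems(1) have "Suc m + card X' \<le> N" by simp
    moreover have "\<alpha> ^ (k + Suc m) \<le> val S i q" if "k \<le> i" "(q, i mod r) \<notin> X'" for q i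
      using that by (intro val_ge_outside_prog[of X m] psubset.prems(2)) (auto simp: X'_def)
    ultimately show ?thesis by (rule psubset.IH)
  qed
qed

lemma good_exists:
  obtains V where "good V"
    "\<And>q i. k \<le> i \<Longrightarrow> val S i q < \<alpha> ^ (k + CARD('q) * r) \<Longrightarrow> (q, i mod r) \<in> V"
proof -
  have "card (UNIV \<times> {..<r} :: ('q \<times> nat) set) = CARD('q) * r"
    by (simp add: card_cartesian_product)
  then obtain V where "good V"
    and V: "\<And>q i. k \<le> i \<Longrightarrow> (q, i mod r) \<notin> V \<Longrightarrow> \<alpha> ^ (k + CARD('q) * r) \<le> val S i q"
    using good_subset[of "UNIV \<times> {..<r}" 0 "CARD('q) * r"] r_pos by auto
  then show thesis using that by (meson not_less)
qed

end

section \<open>Playing inside a good region\<close>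

locale good_region = periodic_target \<delta> \<alpha> S k r
  for \<delta> :: "('q::finite, 'a::finite) mdp" and \<alpha> :: real and S k r +
  fixes V :: "('q \<times> nat) set"
  assumes V_good: "good V"
    and V_pre: "q \<in> pre S i \<Longrightarrow> (q, i mod r) \<in> V"
begin

definition safe :: "nat \<Rightarrow> 'q \<Rightarrow> 'a \<Rightarrow> bool" where
  "safe i q a \<longleftrightarrow> (\<forall>q'\<in>set_pmf (\<delta> q a). (q', i mod r) \<in> V)"

lemma safe_pre: "set_pmf (\<delta> q a) \<subseteq> pre S i \<Longrightarrow> safe i q a"
  using V_pre by (auto simp: safe_def)

text \<open>A derivation of progress begins with a safe action: its step rule supplies one, and a
  sure predecessor has one by \<open>V_pre\<close>.\<close>

lemma safe_exists:
  assumes "(q, Suc i mod r) \<in> V"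
  shows "\<exists>a. safe i q a"
proof -
  obtain i' where "i' mod r = Suc i mod r" "prog V q i'"
    using V_good assms unfolding good_def by blast
  \<comment> \<open>One extra period makes the remaining time positive, so that there is a first
    action.\<close>
  then have i': "(i' + 1 * r) mod r = Suc i mod r" "prog V q (i' + 1 * r)"
    using prog_shift[of V q i' 1] by simp_all
  with r_pos obtain j where j: "i' + 1 * r = Suc j" by (cases "i' + r") auto
  from i'(1) have ji: "j mod r = i mod r" unfolding j
    by (metis add_diff_cancel_left' mod_Suc r_pos nat.inject mod_less_divisor Suc_neq_Zero)
  from i'(2) have "\<exists>a. safe j q a" unfolding j
    by (cases rule: prog.cases) (auto simp: safe_def intro: V_pre)
  with ji show ?thesis by (simp add: safe_def)
qed

text \<open>The optimal error when \<open>V\<close> must not be left. Without a safe action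
  \<open>Min\<close> is taken of the empty set; \<open>safe_exists\<close> excludes this inside
  \<open>V\<close>.\<close>

primrec safe_val :: "nat \<Rightarrow> 'q \<Rightarrow> real" where
  "safe_val 0 q = indicator (- S) q"
| "safe_val (Suc i) q = Min ((\<lambda>a. ev q a (safe_val i)) ` {a. safe i q a})"

lemma safe_val_Suc_le: "safe i q a \<Longrightarrow> safe_val (Suc i) q \<le> ev q a (safe_val i)"
  by simp

definition act :: "nat \<Rightarrow> 'q \<Rightarrow> 'a" where
  "act i q = (SOME a. safe i q a \<and> ev q a (safe_val i) = safe_val (Suc i) q)"

lemma act:
  assumes "(q, Suc i mod r) \<in> V"
  shows "safe i q (act i q)" "ev q (act i q) (safe_val i) = safe_val (Suc i) q"
proof -
  have "safe_val (Suc i) q \<in> (\<lambda>a. ev q a (safe_val i)) ` {a. safe i q a}"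
    unfolding safe_val.simps using safe_exists[OF assms] by (intro Min_in) auto
  then have "\<exists>a. safe i q a \<and> ev q a (safe_val i) = safe_val (Suc i) q" by auto
  from someI_ex[OF this, folded act_def]
  show "safe i q (act i q)" "ev q (act i q) (safe_val i) = safe_val (Suc i) q" by auto
qed

lemma safe_val_pre: "q \<in> pre S i \<Longrightarrow> safe_val i q \<le> 0"
proof (induction i arbitrary: q)
  case (Suc i)
  then obtain a where a: "set_pmf (\<delta> q a) \<subseteq> pre S i" by auto
  have "safe_val (Suc i) q \<le> ev q a (safe_val i)" using a by (intro safe_val_Suc_le safe_pre)
  also have "\<dots> \<le> 0" using a Suc.IH by (intro ev_le) auto
  finally show ?case .
qed simp

lemma safe_val_le_add:
  assumes "\<And>q. (q, i mod r) \<in> V \<Longrightarrow> safe_val i q \<le> \<kappa>"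
  shows "(q, (i + j) mod r) \<in> V \<Longrightarrow> safe_val (i + j) q \<le> \<kappa>"
proof (induction j arbitrary: q)
  case (Suc j)
  then obtain a where a: "safe (i + j) q a" using safe_exists unfolding add_Suc_right by blast
  have "safe_val (Suc (i + j)) q \<le> ev q a (safe_val (i + j))" using a by (rule safe_val_Suc_le)
  also have "\<dots> \<le> \<kappa>" using a by (intro ev_le Suc.IH) (auto simp: safe_def)
  finally show ?case by (simp del: safe_val.simps)
qed (use assms in simp)

lemma safe_val_le_1: "(q, i mod r) \<in> V \<Longrightarrow> safe_val i q \<le> 1"
  using safe_val_le_add[of 0 1 q i] by (simp add: indicator_def)

text \<open>The witnessing path has probability at least \<alpha> per step and ends in a sure
  predecessor, with error 0; off the path, safety bounds the error by \<kappa>.\<close>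

lemma safe_val_prog:
  assumes \<kappa>: "0 \<le> \<kappa>" "\<And>q. (q, k mod r) \<in> V \<Longrightarrow> safe_val (k + t * r) q \<le> \<kappa>"
  shows "prog V q i \<Longrightarrow> safe_val (i + t * r) q \<le> \<kappa> * (1 - \<alpha> ^ i)"
proof (induction rule: prog.induct)
  case (prog_pre i q)
  then have "safe_val (i + t * r) q \<le> 0" by (intro safe_val_pre) (simp add: pre_periodic_mult)
  also have "\<dots> \<le> \<kappa> * (1 - \<alpha> ^ i)" using \<kappa> \<alpha>_power_le_1 by simp
  finally show ?case .
next
  case (prog_step q a i q'')
  have bound: "safe_val (i + t * r) q' \<le> \<kappa>" if "q' \<in> set_pmf (\<delta> q a)" for q'
    using safe_val_le_add[of "k + t * r" \<kappa> q' "i - k"] \<kappa> prog_step.hyps(1)[OF that]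
      prog_ge[OF prog_step.hyps(3)] by (simp add: algebra_simps)
  have "safe_val (Suc (i + t * r)) q \<le> ev q a (safe_val (i + t * r))"
    using prog_step.hyps by (intro safe_val_Suc_le) (auto simp: safe_def)
  also have "\<dots> \<le> \<kappa> - \<alpha> * (\<kappa> * \<alpha> ^ i)"
    using prog_step \<kappa> \<alpha>_pos by (intro ev_le_single bound) (auto simp: algebra_simps)
  finally show ?case by (simp add: algebra_simps del: safe_val.simps)
qed

lemma prog_uniform: "\<exists>M. \<forall>q. (q, k mod r) \<in> V \<longrightarrow> prog V q (k + M * r)"
proof -
  have "\<exists>m. (q, k mod r) \<in> V \<longrightarrow> prog V q (k + m * r)" for q
  proof (cases "(q, k mod r) \<in> V")
    case True
    then obtain i where i: "i mod r = k mod r" "prog V q i"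
      using V_good unfolding good_def by blast
    moreover have "i = k + ((i - k) div r) * r"
      using i(1) prog_ge[OF i(2)] by (metis dvd_div_mult_self le_add_diff_inverse mod_eq_dvd_iff_nat)
    ultimately show ?thesis by metis
  qed simp
  then obtain m where m: "\<And>q. (q, k mod r) \<in> V \<Longrightarrow> prog V q (k + m q * r)" by metis
  define M where "M = Max (range m)"
  have "prog V q (k + M * r)" if "(q, k mod r) \<in> V" for q
  proof -
    have "m q \<le> M" by (simp add: M_def)
    then have "M = m q + (M - m q)" by simp
    then have "k + M * r = k + m q * r + (M - m q) * r"
      by (metis add.assoc add_mult_distrib)
    with prog_shift[OF m[OF that], of "M - m q"] show ?thesis by (simp only:)
  qed
  then show ?thesis by blast
qed

text \<open>By \<open>prog_uniform\<close> one horizon serves all states, so each block of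
  \<open>M * r\<close> further steps contracts the uniform bound by the factor
  \<open>b < 1\<close>.\<close>

lemma safe_val_vanishes:
  assumes "0 < \<eta>"
  shows "\<exists>I. \<forall>i\<ge>I. \<forall>q. (q, i mod r) \<in> V \<longrightarrow> safe_val i q \<le> \<eta>"
proof -
  obtain M where M: "\<And>q. (q, k mod r) \<in> V \<Longrightarrow> prog V q (k + M * r)"
    using prog_uniform by blast
  define b where "b = 1 - \<alpha> ^ (k + M * r)"
  have b: "0 \<le> b" "b < 1" using \<alpha>_pos \<alpha>_power_le_1 by (auto simp: b_def)
  have decay: "safe_val (k + (t * M) * r) q \<le> b ^ t" if "(q, k mod r) \<in> V" for t q
    using that
  proof (induction t arbitrary: q)
    case 0
    then show ?case using safe_val_le_1[of q k] by simp
  next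
    case (Suc t)
    have "safe_val (k + M * r + (t * M) * r) q \<le> b ^ t * b"
      unfolding b_def using b Suc by (intro safe_val_prog M) (auto simp: b_def)
    then show ?case by (simp add: algebra_simps)
  qed
  obtain t where t: "b ^ t < \<eta>" using real_arch_pow_inv[OF assms b(2)] by blast
  have "safe_val i q \<le> \<eta>" if "k + (t * M) * r \<le> i" "(q, i mod r) \<in> V" for i q
    using safe_val_le_add[of "k + (t * M) * r" "b ^ t" q "i - (k + (t * M) * r)"] decay that t
    by simp
  then show ?thesis by blast
qed

text \<open>Under \<open>act\<close> the expected \<open>safe_val\<close> of the remaining horizon
  is constant, and at horizon 0 it is the mass outside \<open>S\<close>. Where \<open>act\<close> is
  arbitrary, outside \<open>V\<close>, there is no mass.\<close>

lemma distribution_segment: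
  fixes D :: "nat \<Rightarrow> 'q \<Rightarrow> real"
  assumes D: "\<And>s q'. D (Suc s) q' = (\<Sum>q\<in>UNIV. D s q * pmf (\<delta> q (\<tau> s q)) q')"
    and supp: "\<And>q. D s q \<noteq> 0 \<Longrightarrow> (q, i mod r) \<in> V"
    and \<tau>: "\<And>l. l < i \<Longrightarrow> \<tau> (s + l) = act (i - Suc l)"
  shows "(\<forall>q. D (s + i) q \<noteq> 0 \<longrightarrow> (q, 0) \<in> V) \<and>
    mass (D (s + i)) (- S) = (\<Sum>q\<in>UNIV. D s q * safe_val i q)"
  using supp \<tau>
proof (induction i arbitrary: s)
  case 0
  have "(\<Sum>q\<in>UNIV. D s q * indicator (- S) q) = mass (D s) (- S)"
    unfolding mass_def sum_mult_indicator[OF finite] by (intro sum.cong) auto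
  with 0 show ?case by simp
next
  case (Suc i)
  have \<tau>s: "\<tau> s = act i" using Suc.prems(2)[of 0] by simp
  have "(q', i mod r) \<in> V" if "D (Suc s) q' \<noteq> 0" for q'
  proof -
    from that obtain q where "D s q * pmf (\<delta> q (\<tau> s q)) q' \<noteq> 0"
      unfolding D by (meson sum.neutral)
    then have "D s q \<noteq> 0" "q' \<in> set_pmf (\<delta> q (act i q))" by (auto simp: set_pmf_iff \<tau>s)
    with act(1)[OF Suc.prems(1)[of q]] show ?thesis by (auto simp: safe_def)
  qed
  moreover have "\<tau> (Suc s + l) = act (i - Suc l)" if "l < i" for l
    using Suc.prems(2)[of "Suc l"] that by simp
  ultimately have IH: "\<forall>q. D (Suc s + i) q \<noteq> 0 \<longrightarrow> (q, 0) \<in> V"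
    "mass (D (Suc s + i)) (- S) = (\<Sum>q\<in>UNIV. D (Suc s) q * safe_val i q)"
    using Suc.IH[of "Suc s"] by blast+
  have "(\<Sum>q'\<in>UNIV. D (Suc s) q' * safe_val i q') =
      (\<Sum>q'\<in>UNIV. \<Sum>q\<in>UNIV. D s q * (pmf (\<delta> q (\<tau> s q)) q' * safe_val i q'))"
    by (simp add: D sum_distrib_right mult.assoc)
  also have "\<dots> = (\<Sum>q\<in>UNIV. D s q * ev q (act i q) (safe_val i))"
    by (subst sum.swap) (simp add: ev_def sum_distrib_left \<tau>s)
  also have "\<dots> = (\<Sum>q\<in>UNIV. D s q * safe_val (Suc i) q)"
  proof (intro sum.cong refl)
    fix q
    show "D s q * ev q (act i q) (safe_val i) = D s q * safe_val (Suc i) q"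
      using act(2)[OF Suc.prems(1)[of q]] by (cases "D s q = 0") (simp_all del: safe_val.simps)
  qed
  finally show ?case using IH by (simp del: safe_val.simps)
qed

text \<open>Round \<open>t\<close> ends at \<open>tt (Suc t)\<close> and is played optimally for its
  own length. Its final error is small from any distribution on \<open>V\<close>, so earlier misses
  do not accumulate.\<close>

theorem almost_sure_weakly_sync_of_region:
  assumes d0: "\<And>q. q \<in> set_pmf d\<^sub>0 \<Longrightarrow> (q, c mod r) \<in> V"
  shows "almost_sure_weakly_sync \<delta> d\<^sub>0 S"
proof -
  have "\<exists>I. \<forall>i\<ge>I. \<forall>q. (q, i mod r) \<in> V \<longrightarrow> safe_val i q \<le> 1 / real (Suc t)" for t
    by (rule safe_val_vanishes) simp
  then obtain I where I: "\<And>t i q. I t \<le> i \<Longrightarrow> (q, i mod r) \<in> V \<Longrightarrow> safe_val i q \<le> 1 / real (Suc t)"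
    by metis
  \<comment> \<open>A multiple of \<open>r\<close> makes every round start and end at residue 0;
    \<open>Suc\<close> makes it nonempty.\<close>
  define L where "L t = r * Suc (I t)" for t
  have L: "I t \<le> L t" "0 < L t" "L t mod r = 0" for t
  proof -
    show "I t \<le> L t" using r_pos by (auto simp: L_def intro: trans_le_add2)
  qed (use r_pos in \<open>auto simp: L_def\<close>)
  define tt where "tt = rec_nat c (\<lambda>t x. x + L t)"
  have tt: "tt 0 = c" "tt (Suc t) = tt t + L t" for t by (simp_all add: tt_def)
  have tt_mono: "strict_mono tt" by (rule strict_monoI_Suc) (simp add: tt L)
  define tgt where "tgt s = tt (LEAST t. s < tt t)" for s
  have tgt_0: "tgt s = c" if "s < c" for s
    using that tt(1) by (simp add: tgt_def Least_equality)
  have tgt_Suc: "tgt s = tt (Suc t)" if "tt t \<le> s" "s < tt (Suc t)" for s t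
  proof -
    have "(LEAST t. s < tt t) = Suc t"
    proof (rule Least_equality)
      fix t' assume "s < tt t'"
      with that(1) have "tt t < tt t'" by simp
      then show "Suc t \<le> t'" using tt_mono by (simp add: strict_mono_less Suc_leI)
    qed (rule that(2))
    then show ?thesis by (simp add: tgt_def)
  qed
  \<comment> \<open>\<open>act i\<close> is the choice with \<open>Suc i\<close> steps left, and
    \<open>tgt s - s\<close> steps are left at time \<open>s\<close>.\<close>
  define \<tau> where "\<tau> s = act (tgt s - Suc s)" for s
  define \<sigma> where "\<sigma> = (\<lambda>h q. return_pmf (\<tau> (length (h :: ('q \<times> 'a) list)) q))"
  define D where "D = state_dist \<delta> \<sigma> d\<^sub>0"
  have D_Suc: "D (Suc s) q' = (\<Sum>q\<in>UNIV. D s q * pmf (\<delta> q (\<tau> s q)) q')" for s q'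
    unfolding D_def by (rule state_dist_Suc_markov[OF \<sigma>_def])
  have "D 0 q \<noteq> 0 \<Longrightarrow> (q, c mod r) \<in> V" for q
    by (rule d0) (simp add: D_def state_dist_0 set_pmf_iff)
  then have init: "\<forall>q. D c q \<noteq> 0 \<longrightarrow> (q, 0) \<in> V"
    using distribution_segment[of D \<tau> 0 c, OF D_Suc] by (simp add: \<tau>_def tgt_0)
  have seg: "(\<forall>q. D (tt t + L t) q \<noteq> 0 \<longrightarrow> (q, 0) \<in> V) \<and>
      mass (D (tt t + L t)) (- S) = (\<Sum>q\<in>UNIV. D (tt t) q * safe_val (L t) q)"
    if "\<forall>q. D (tt t) q \<noteq> 0 \<longrightarrow> (q, 0) \<in> V" for t
  proof (rule distribution_segment[of D \<tau>, OF D_Suc])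
    fix l assume "l < L t"
    then show "\<tau> (tt t + l) = act (L t - Suc l)" by (simp add: \<tau>_def tgt_Suc[of t] tt)
  qed (use that L in auto)
  have supp: "\<forall>q. D (tt t) q \<noteq> 0 \<longrightarrow> (q, 0) \<in> V" for t
    by (induction t) (use init seg in \<open>auto simp: tt\<close>)
  have mass_ge: "1 - 1 / real (Suc t) \<le> mass (D (tt (Suc t))) S" for t
  proof -
    have total: "(\<Sum>q\<in>UNIV. D s q) = 1" for s
      unfolding D_def by (rule sum_state_dist)
    have "mass (D (tt (Suc t))) (- S) \<le> (\<Sum>q\<in>UNIV. D (tt t) q * (1 / real (Suc t)))"
      unfolding tt conjunct2[OF seg[OF supp]]
    proof (rule sum_mono)
      fix q
      show "D (tt t) q * safe_val (L t) q \<le> D (tt t) q * (1 / real (Suc t))"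
      proof (cases "D (tt t) q = 0")
        case False
        then have "safe_val (L t) q \<le> 1 / real (Suc t)" using I[of t "L t" q] L[of t] supp[of t] by simp
        then show ?thesis by (rule mult_left_mono) (simp add: D_def state_dist_nonneg)
      qed simp
    qed
    also have "\<dots> = 1 / real (Suc t)" by (simp only: sum_distrib_right[symmetric] total mult_1)
    finally have "mass (D (tt (Suc t))) (- S) \<le> 1 / real (Suc t)" .
    moreover have "mass (D s) S + mass (D s) (- S) = 1" for s
      unfolding mass_def total[of s, symmetric]
      by (subst sum.union_disjoint[symmetric]) (auto simp: Compl_partition)
    ultimately show ?thesis by (smt (verit))
  qed
  have "\<exists>\<^sub>\<infinity>i. 1 - \<epsilon> \<le> mass (D i) S" if "0 < \<epsilon>" for \<epsilon>
    unfolding INFM_nat_le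
  proof
    fix m
    obtain t0 where t0: "1 / real (Suc t0) < \<epsilon>" using nat_approx_posE[OF \<open>0 < \<epsilon>\<close>] by blast
    define t where "t = max m t0"
    have "1 / real (Suc t) \<le> 1 / real (Suc t0)" by (rule divide_left_mono) (auto simp: t_def)
    with t0 mass_ge[of t] have "1 - \<epsilon> \<le> mass (D (tt (Suc t))) S" by linarith
    moreover have "m \<le> tt (Suc t)"
      using strict_mono_imp_increasing[OF tt_mono, of "Suc t"] by (simp add: t_def)
    ultimately show "\<exists>n\<ge>m. 1 - \<epsilon> \<le> mass (D n) S" by blast
  qed
  then show ?thesis unfolding almost_sure_weakly_sync_def D_def by blast
qed

end

subsection \<open>Repeated near-certainty implies almost-sure synchronization\<close>

context bounded_mdp
begin

text \<open>Whatever actions a strategy mixes, a step cannot lower the expected value of the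
  remaining horizon.\<close>

lemma state_dist_val_le:
  "(\<Sum>q\<in>UNIV. state_dist \<delta> \<sigma> d\<^sub>0 i q * val S p q) \<le> mass (state_dist \<delta> \<sigma> d\<^sub>0 (i + p)) (- S)"
proof (induction p arbitrary: i)
  case 0
  have "(\<Sum>q\<in>UNIV. state_dist \<delta> \<sigma> d\<^sub>0 i q * indicator (- S) q) = mass (state_dist \<delta> \<sigma> d\<^sub>0 i) (- S)"
    unfolding mass_def sum_mult_indicator[OF finite] by (intro sum.cong) auto
  then show ?case by simp
next
  case (Suc p)
  have "(\<Sum>q\<in>UNIV. state_dist \<delta> \<sigma> d\<^sub>0 i q * val S (Suc p) q) =
      (\<Sum>q\<in>UNIV. \<Sum>a\<in>UNIV. joint_dist \<delta> \<sigma> d\<^sub>0 i q a * val S (Suc p) q)"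
    by (simp only: state_dist_eq_sum_joint sum_distrib_right)
  also have "\<dots> \<le> (\<Sum>q\<in>UNIV. \<Sum>a\<in>UNIV. joint_dist \<delta> \<sigma> d\<^sub>0 i q a * ev q a (val S p))"
    by (intro sum_mono mult_left_mono val_Suc_le joint_dist_nonneg)
  also have "\<dots> = (\<Sum>q\<in>UNIV. \<Sum>q'\<in>UNIV. \<Sum>a\<in>UNIV.
      joint_dist \<delta> \<sigma> d\<^sub>0 i q a * pmf (\<delta> q a) q' * val S p q')"
    by (subst sum.swap[of _ UNIV UNIV]) (simp only: ev_def sum_distrib_left mult.assoc)
  also have "\<dots> = (\<Sum>q'\<in>UNIV. state_dist \<delta> \<sigma> d\<^sub>0 (Suc i) q' * val S p q')"
    by (subst sum.swap) (simp only: state_dist_Suc sum_distrib_right)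
  also have "\<dots> \<le> mass (state_dist \<delta> \<sigma> d\<^sub>0 (Suc i + p)) (- S)" by (rule Suc.IH)
  finally show ?case by simp
qed

text \<open>
  Replacing the delay \<open>p\<close> by the multiple \<open>r * p\<close> of the period multiplies the error by
  \<open>r \<le> 2 ^ CARD('q)\<close>, which the extra factor \<open>\<alpha> ^ (CARD('q) + 1)\<close> absorbs when \<open>\<alpha> \<le> 1 / 2\<close>; when
  \<open>\<alpha> = 1\<close> all values are \<open>0\<close> or \<open>1\<close>.
\<close>

lemma val_small_return:
  assumes \<alpha>: "\<alpha> = 1 \<or> \<alpha> \<le> 1 / 2"
    and p: "0 < p" and S: "\<And>q. q \<in> S \<Longrightarrow> val S p q < \<alpha> ^ (e + CARD('q) + 1)"
    and kr: "0 < r" "k + r \<le> 2 ^ CARD('q)" "2 ^ CARD('q) \<le> e"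
  shows "\<exists>m \<eta>. k \<le> m \<and> m mod r = 0 \<and> 0 \<le> \<eta> \<and> \<eta> < \<alpha> ^ e \<and> (\<forall>q\<in>S. val S m q \<le> \<eta>)"
proof (cases "\<alpha> = 1 \<or> p < k")
  case True
  then have "\<alpha> ^ (e + CARD('q) + 1) \<le> \<alpha> ^ p"
  proof
    assume "p < k"
    with kr show ?thesis by (intro \<alpha>_power_antimono) simp
  qed simp
  \<comment> \<open>By the gap the return is sure and can be repeated without error, so a multiple
    of \<open>p\<close> that is also a multiple of \<open>r\<close> and at least \<open>k\<close>
    can be taken.\<close>
  then have "S \<subseteq> pre S p" using S val_ge_outside_pre[of _ S p] by fastforce
  then have "S \<subseteq> pre S (k * r * p + r * p)" using pre_mult[of S p "k * r + r"] by (simp add: add_mult_distrib)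
  then have "\<forall>q\<in>S. val S (k * r * p + r * p) q \<le> 0" by (auto simp: val_pre)
  moreover have "k \<le> k * r * p + r * p"
    using p kr(1) by (simp add: trans_le_add1 mult.assoc)
  moreover have "0 < \<alpha> ^ e" using \<alpha>_pos by simp
  ultimately show ?thesis by (intro exI[of _ "k * r * p + r * p"] exI[of _ 0]) auto
next
  case False
  with \<alpha> have half: "\<alpha> \<le> 1 / 2" and "k \<le> p" by auto
  let ?\<eta> = "real r * \<alpha> ^ (e + CARD('q) + 1)"
  have "val S (r * p) q \<le> ?\<eta>" if "q \<in> S" for q
    using S \<alpha>_pos that by (intro val_mult) (auto intro: less_imp_le)
  moreover have "?\<eta> < \<alpha> ^ e"
  proof -
    have "r \<le> 2 ^ CARD('q)" using kr by simp
    then have "real r \<le> 2 ^ CARD('q)" by (metis of_nat_le_iff of_nat_numeral of_nat_power)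
    moreover have "\<alpha> ^ (CARD('q) + 1) \<le> (1 / 2) ^ (CARD('q) + 1)"
      using half \<alpha>_pos by (intro power_mono) auto
    ultimately have "real r * \<alpha> ^ (CARD('q) + 1) \<le> 2 ^ CARD('q) * (1 / 2) ^ (CARD('q) + 1)"
      using \<alpha>_pos by (intro mult_mono) auto
    also have "\<dots> = 1 / 2" by (simp add: power_one_over)
    finally have "real r * \<alpha> ^ (CARD('q) + 1) < 1" by simp
    then have "\<alpha> ^ e * (real r * \<alpha> ^ (CARD('q) + 1)) < \<alpha> ^ e * 1"
      using \<alpha>_pos by (intro mult_strict_left_mono) auto
    then show ?thesis by (simp add: power_add algebra_simps)
  qed
  moreover have "k \<le> r * p"
    using \<open>k \<le> p\<close> kr(1) by (metis One_nat_def Suc_leI le_trans mult_le_mono1 nat_mult_1)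
  ultimately show ?thesis
    using \<alpha>_pos by (intro exI[of _ "r * p"] exI[of _ ?\<eta>]) auto
qed

text \<open>Smallness on \<open>S\<close> puts all sure predecessors into a good region, smallness
  on \<open>d\<^sub>0\<close> the initial states. The exponent \<open>e\<close> dominates
  \<open>k + CARD('q) * r\<close>.\<close>

theorem almost_sure_weakly_syncI:
  fixes S :: "'q set"
  defines "e \<equiv> CARD('q) * 2 ^ CARD('q)"
  assumes \<alpha>: "\<alpha> = 1 \<or> \<alpha> \<le> 1 / 2"
    and p: "0 < p" and S: "\<And>q. q \<in> S \<Longrightarrow> val S p q < \<alpha> ^ (e + CARD('q) + 1)"
    and d0: "\<And>q. q \<in> set_pmf d\<^sub>0 \<Longrightarrow> val S c q < \<alpha> ^ (e + CARD('q) + 1)"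
  shows "almost_sure_weakly_sync \<delta> d\<^sub>0 S"
proof -
  obtain k r where kr: "k + r \<le> 2 ^ CARD('q)" and r: "0 < r"
    and periodic: "\<And>i. k \<le> i \<Longrightarrow> pre S (i + r) = pre S i"
    by (rule pre_eventually_periodic[of S]) blast
  interpret periodic_target \<delta> \<alpha> S k r
    by unfold_locales (use r periodic in auto)
  obtain V where good: "good V"
    and V: "\<And>q i. k \<le> i \<Longrightarrow> val S i q < \<alpha> ^ (k + CARD('q) * r) \<Longrightarrow> (q, i mod r) \<in> V"
    by (rule good_exists) blast
  have card: "1 \<le> CARD('q)" by (simp add: Suc_leI)
  then have e_ge: "2 ^ CARD('q) \<le> e" by (simp add: e_def)
  have "k + CARD('q) * r \<le> CARD('q) * (k + r)" using card by (simp add: add_mult_distrib2)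
  also have "\<dots> \<le> e" unfolding e_def by (intro mult_le_mono2 kr)
  finally have le_gap: "\<alpha> ^ e \<le> \<alpha> ^ (k + CARD('q) * r)" by (rule \<alpha>_power_antimono)
  have "\<exists>m \<eta>. k \<le> m \<and> m mod r = 0 \<and> 0 \<le> \<eta> \<and> \<eta> < \<alpha> ^ e \<and> (\<forall>q\<in>S. val S m q \<le> \<eta>)"
    using \<alpha> p S r kr e_ge by (rule val_small_return)
  then obtain m \<eta> where m: "k \<le> m" "m mod r = 0"
    and \<eta>: "0 \<le> \<eta>" "\<eta> < \<alpha> ^ e" "\<And>q. q \<in> S \<Longrightarrow> val S m q \<le> \<eta>"
    by (elim exE conjE) auto
  have V_pre: "(q, i mod r) \<in> V" if "q \<in> pre S i" for q i
  proof -
    \<comment> \<open>Going surely to \<open>S\<close> in \<open>i\<close> steps and then returning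
      in \<open>m\<close> steps makes the horizon at least \<open>k\<close> without changing its
      residue.\<close>
    have "val S (m + i) q \<le> \<eta> + val S i q" by (intro val_add \<eta>)
    also have "\<dots> < \<alpha> ^ (k + CARD('q) * r)" using that \<eta>(2) le_gap by (simp add: val_pre)
    finally have "(q, (m + i) mod r) \<in> V" using m by (intro V) auto
    then show ?thesis using m(2) by (metis add.left_neutral mod_add_left_eq)
  qed
  interpret good_region \<delta> \<alpha> S k r V
    by unfold_locales (use good V_pre in auto)
  have "(q, c mod r) \<in> V" if q: "q \<in> set_pmf d\<^sub>0" for q
  proof (cases "k \<le> c")
    case True
    have "\<alpha> ^ (e + CARD('q) + 1) \<le> \<alpha> ^ e" by (rule \<alpha>_power_antimono) simp
    with d0[OF q] le_gap True show ?thesis by (intro V) auto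
  next
    case False
    \<comment> \<open>For a horizon below \<open>k\<close> the value is under
      \<open>\<alpha> ^ c\<close>, hence 0.\<close>
    with kr e_ge have "\<alpha> ^ (e + CARD('q) + 1) \<le> \<alpha> ^ c" by (intro \<alpha>_power_antimono) simp
    with d0[OF q] have "q \<in> pre S c" using val_ge_outside_pre[of q S c] by fastforce
    then show ?thesis by (rule V_pre)
  qed
  then show ?thesis by (rule almost_sure_weakly_sync_of_region)
qed

end

section \<open>Constants, thresholds and the final counting\<close>

lemma min_trans_prob:
  fixes \<delta> :: "('q::finite, 'a::finite) mdp"
  shows "0 < min_trans_prob \<delta>" "0 < pmf (\<delta> q a) q' \<Longrightarrow> min_trans_prob \<delta> \<le> pmf (\<delta> q a) q'"
    and "min_trans_prob \<delta> = 1 \<or> min_trans_prob \<delta> \<le> 1 / 2"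
proof -
  let ?A = "{pmf (\<delta> q a) q' | q a q'. 0 < pmf (\<delta> q a) q'}"
  have "?A \<subseteq> (\<Union>q. \<Union>a. range (pmf (\<delta> q a)))" by auto
  then have fin: "finite ?A" by (rule finite_subset) simp
  obtain q' where "q' \<in> set_pmf (\<delta> undefined undefined)" using set_pmf_not_empty by fast
  then have "?A \<noteq> {}" using pmf_positive by fast
  then have in_A: "min_trans_prob \<delta> \<in> ?A"
    unfolding min_trans_prob_def by (intro Min_in fin)
  then show "0 < min_trans_prob \<delta>" by auto
  show le: "min_trans_prob \<delta> \<le> pmf (\<delta> q a) q'" if "0 < pmf (\<delta> q a) q'" for q a q'
    unfolding min_trans_prob_def using that by (intro Min_le fin) auto
  from in_A obtain q a q' where \<alpha>: "min_trans_prob \<delta> = pmf (\<delta> q a) q'" by auto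
  show "min_trans_prob \<delta> = 1 \<or> min_trans_prob \<delta> \<le> 1 / 2"
  \<comment> \<open>A minimal transition that is not certain has a sibling at least as probable, and
    the two sum to at most 1.\<close>
  proof (cases "set_pmf (\<delta> q a) \<subseteq> {q'}")
    case True
    then have "pmf (\<delta> q a) q' = 1"
      using sum_pmf_eq_1[of "{q'}" "\<delta> q a"] by simp
    with \<alpha> show ?thesis by simp
  next
    case False
    then obtain q'' where q'': "q'' \<in> set_pmf (\<delta> q a)" "q'' \<noteq> q'" by auto
    have "pmf (\<delta> q a) q' + pmf (\<delta> q a) q'' = (\<Sum>x\<in>{q', q''}. pmf (\<delta> q a) x)"
      using q'' by simp
    also have "\<dots> \<le> (\<Sum>x\<in>UNIV. pmf (\<delta> q a) x)" by (intro sum_mono2) auto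
    also have "\<dots> = 1" by (rule sum_pmf_eq_1) auto
    finally have "pmf (\<delta> q a) q' + pmf (\<delta> q a) q'' \<le> 1" .
    with le[of q a q''] q'' \<alpha> show ?thesis by (simp add: pmf_positive)
  qed
qed

lemma min_init_prob:
  fixes d\<^sub>0 :: "'q::finite pmf"
  shows "0 < min_init_prob d\<^sub>0" "q \<in> set_pmf d\<^sub>0 \<Longrightarrow> min_init_prob d\<^sub>0 \<le> pmf d\<^sub>0 q"
proof -
  let ?A = "{pmf d\<^sub>0 q | q. 0 < pmf d\<^sub>0 q}"
  have "?A \<subseteq> pmf d\<^sub>0 ` UNIV" by auto
  then have fin: "finite ?A" by (rule finite_subset) simp
  obtain q where "q \<in> set_pmf d\<^sub>0" using set_pmf_not_empty by fast
  then have "?A \<noteq> {}" using pmf_positive by fast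
  then have "min_init_prob d\<^sub>0 \<in> ?A" unfolding min_init_prob_def by (intro Min_in fin)
  then show "0 < min_init_prob d\<^sub>0" by auto
  show "min_init_prob d\<^sub>0 \<le> pmf d\<^sub>0 q" if "q \<in> set_pmf d\<^sub>0" for q
    unfolding min_init_prob_def using that pmf_positive[OF that] by (intro Min_le fin) auto
qed

text \<open>The left side is the exponent of \<alpha> in the smallest threshold: one gap for each of
  the \<open>2 ^ n + 1\<close> instants.\<close>

lemma exponent_bound:
  assumes "1 \<le> n"
  shows "(n * 2 ^ n + n + 1) * (2 ^ n + 1) \<le> (n + 2) * 4 ^ n"
proof -
  define s :: nat where "s = 2 ^ n"
  have "n + 1 \<le> s" unfolding s_def by (simp add: Suc_leI less_exp)
  \<comment> \<open>Substituting for \<open>s\<close> leaves a comparison of polynomials in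
    \<open>n\<close> and \<open>j\<close> coefficient by coefficient.\<close>
  then obtain j where s: "s = n + 1 + j" by (auto simp: le_iff_add)
  have "(n * s + n + 1) * (s + 1) \<le> (n + 2) * (s * s)"
    unfolding s by (simp add: algebra_simps)
  moreover have "s * s = 4 ^ n" by (simp add: s_def power_mult_distrib[symmetric])
  ultimately show ?thesis by (simp add: s_def)
qed

text \<open>If \<open>T\<close> is proper, it has at most \<open>CARD('q) - 1\<close> light states,
  and the mass outside \<open>T\<close>, below \<theta>, fills the spare place. If \<open>T\<close>
  is everything, strictness comes from the light states themselves.\<close>

lemma mass_outside_heavy_less:
  fixes d :: "'q::finite \<Rightarrow> real"
  assumes "(\<Sum>q\<in>UNIV. d q) = 1" "mass d T > 1 - \<theta>" "0 < \<theta>"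
  shows "mass d (- {q \<in> T. \<theta> \<le> d q}) < real CARD('q) * \<theta>"
proof (cases "T = UNIV")
  case True
  let ?B = "- {q. \<theta> \<le> d q}"
  show ?thesis
  proof (cases "?B = {}")
    case False
    have "mass d ?B < (\<Sum>q\<in>?B. \<theta>)"
      unfolding mass_def by (rule sum_strict_mono) (use False in auto)
    also have "\<dots> \<le> real CARD('q) * \<theta>"
      using assms(3) card_mono[of UNIV ?B] by (simp add: mult_right_mono)
    finally show ?thesis using True by simp
  qed (use True assms(3) in \<open>auto simp: mass_def\<close>)
next
  case False
  let ?B = "{q \<in> T. d q < \<theta>}"
  have "card ?B < CARD('q)" using False by (intro psubset_card_mono) auto
  then have "real (card ?B) + 1 \<le> real CARD('q)" by linarith
  then have "(real (card ?B) + 1) * \<theta> \<le> real CARD('q) * \<theta>"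
    using assms(3) by (intro mult_right_mono) auto
  moreover have "mass d ?B \<le> real (card ?B) * \<theta>"
    unfolding mass_def by (rule sum_bounded_above) auto
  moreover have "mass d T + mass d (- T) = 1"
    unfolding mass_def assms(1)[symmetric]
    by (subst sum.union_disjoint[symmetric]) (auto simp: Compl_partition)
  moreover have "- {q \<in> T. \<theta> \<le> d q} = ?B \<union> - T" by auto
  then have "mass d (- {q \<in> T. \<theta> \<le> d q}) = mass d ?B + mass d (- T)"
    unfolding mass_def by (simp only:) (subst sum.union_disjoint, auto)
  ultimately show ?thesis using assms(2) by (simp add: algebra_simps)
qed

theorem theorem2:
  fixes \<delta> :: "('q::finite, 'a::finite) mdp"
    and d\<^sub>0 :: "'q pmf"
    and T :: "'q set"
    and n N\<^sub>w :: nat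
    and \<alpha> \<alpha>\<^sub>0 \<epsilon>\<^sub>w :: real
  assumes "n = CARD('q)"
    and "\<alpha> = min_trans_prob \<delta>"
    and "\<alpha>\<^sub>0 = min_init_prob d\<^sub>0"
    and "\<epsilon>\<^sub>w = \<alpha>\<^sub>0 * (\<alpha> ^ ((n + 2) * 4 ^ n) / real n ^ (2 ^ n + 1))"
    and "N\<^sub>w = 2 ^ n"
    and "\<not> almost_sure_weakly_sync \<delta> d\<^sub>0 T"
  shows "\<forall>\<sigma>. finite {i. mass (state_dist \<delta> \<sigma> d\<^sub>0 i) T > 1 - \<epsilon>\<^sub>w} \<and>
             card {i. mass (state_dist \<delta> \<sigma> d\<^sub>0 i) T > 1 - \<epsilon>\<^sub>w} \<le> N\<^sub>w"
proof (rule allI, rule ccontr)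
  fix \<sigma>
  define D where "D = state_dist \<delta> \<sigma> d\<^sub>0"
  define A where "A = {i. mass (D i) T > 1 - \<epsilon>\<^sub>w}"
  assume "\<not> (finite {i. mass (state_dist \<delta> \<sigma> d\<^sub>0 i) T > 1 - \<epsilon>\<^sub>w} \<and>
             card {i. mass (state_dist \<delta> \<sigma> d\<^sub>0 i) T > 1 - \<epsilon>\<^sub>w} \<le> N\<^sub>w)"
  then have "infinite A \<or> Suc (2 ^ n) \<le> card A"
    using assms(5) by (auto simp: A_def D_def)
  then obtain B where B: "B \<subseteq> A" "finite B" "card B = Suc (2 ^ n)"
    by (metis infinite_arbitrarily_large obtain_subset_with_card_n)
  define ix where "ix m = sorted_list_of_set B ! m" for m
  have ix_less: "ix j < ix l" if "j < l" "l \<le> 2 ^ n" for j l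
    unfolding ix_def using that B
    by (intro sorted_wrt_nth_less[OF strict_sorted_list_of_set]) auto
  have ix_A: "ix m \<in> A" if "m \<le> 2 ^ n" for m
    using that B nth_mem[of m "sorted_list_of_set B"] by (auto simp: ix_def)
  interpret bounded_mdp \<delta> \<alpha>
    unfolding assms(2) by unfold_locales (rule min_trans_prob, erule min_trans_prob)
  have \<alpha>\<^sub>0: "0 < \<alpha>\<^sub>0" unfolding assms(3) by (rule min_init_prob)
  have n: "1 \<le> n" by (simp add: assms(1) Suc_leI)
  define g where "g = \<alpha> ^ (n * 2 ^ n + n + 1)"
  have g: "0 < g" "g \<le> 1"
    unfolding g_def by (rule zero_less_power[OF \<alpha>_pos], rule \<alpha>_power_le_1)
  \<comment> \<open>Chosen so that the error \<open>n * \<theta> m\<close> is the gap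
    \<open>g\<close> times the previous threshold, or times \<open>\<alpha>\<^sub>0\<close> for
    \<open>m = 0\<close>.\<close>
  define \<theta> where "\<theta> m = \<alpha>\<^sub>0 * (g / real n) ^ (m + 1)" for m
  have \<theta>_pos: "0 < \<theta> m" for m using \<alpha>\<^sub>0 g n by (simp add: \<theta>_def)
  have \<theta>_0: "real n * \<theta> 0 = \<alpha>\<^sub>0 * g" and \<theta>_Suc: "real n * \<theta> (Suc m) = \<theta> m * g" for m
    using n by (simp_all add: \<theta>_def)
  have "g / real n \<le> 1" using g n by (simp add: divide_le_eq)
  then have \<theta>_antimono: "\<theta> l \<le> \<theta> j" if "j \<le> l" for j l
    unfolding \<theta>_def using that \<alpha>\<^sub>0 g by (intro mult_left_mono power_decreasing) auto
  have "\<epsilon>\<^sub>w \<le> \<theta> (2 ^ n)"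
  proof -
    have "\<alpha> ^ ((n + 2) * 4 ^ n) \<le> g ^ (2 ^ n + 1)"
      unfolding g_def power_mult[symmetric] by (intro \<alpha>_power_antimono exponent_bound n)
    then show ?thesis
      unfolding assms(4) \<theta>_def power_divide using \<alpha>\<^sub>0 n
      by (intro mult_left_mono divide_right_mono) auto
  qed
  define S where "S m = {q \<in> T. \<theta> m \<le> D (ix m) q}" for m
  have outside: "mass (D (ix m)) (- S m) < real n * \<theta> m" if "m \<le> 2 ^ n" for m
    unfolding S_def assms(1)
  proof (rule mass_outside_heavy_less)
    show "(\<Sum>q\<in>UNIV. D (ix m) q) = 1" unfolding D_def by (rule sum_state_dist)
    show "1 - \<theta> m < mass (D (ix m)) T"
      using ix_A[OF that] \<open>\<epsilon>\<^sub>w \<le> \<theta> (2 ^ n)\<close> \<theta>_antimono[OF that] by (simp add: A_def)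
  qed (rule \<theta>_pos)
  have "card (S ` {..2 ^ n}) \<le> card (UNIV :: 'q set set)" by (intro card_mono) auto
  also have "\<dots> < card {..2 ^ n :: nat}" using card_Pow[of "UNIV :: 'q set"] by (simp add: assms(1))
  finally have "\<not> inj_on S {..2 ^ n}" by (rule pigeonhole)
  then obtain j l where jl: "j < l" "l \<le> 2 ^ n" "S j = S l"
    unfolding inj_on_def by (metis atMost_iff linorder_neqE_nat)
  have val_le: "D i q * val (S l) p q \<le> mass (D (i + p)) (- S l)" for i p q
  proof -
    have "D i q * val (S l) p q \<le> (\<Sum>q\<in>UNIV. D i q * val (S l) p q)"
      by (rule member_le_sum) (auto simp: D_def state_dist_nonneg val_nonneg)
    also have "\<dots> \<le> mass (D (i + p)) (- S l)" unfolding D_def by (rule state_dist_val_le)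
    finally show ?thesis .
  qed
  have "almost_sure_weakly_sync \<delta> d\<^sub>0 (S l)"
  proof (rule almost_sure_weakly_syncI)
    show "\<alpha> = 1 \<or> \<alpha> \<le> 1 / 2" unfolding assms(2) by (rule min_trans_prob)
    show "0 < ix l - ix j" using ix_less jl by simp
    show "val (S l) (ix l - ix j) q < \<alpha> ^ (CARD('q) * 2 ^ CARD('q) + CARD('q) + 1)"
      if "q \<in> S l" for q
    proof -
      \<comment> \<open>As \<open>S j = S l\<close>, the state weighs at least
        \<open>\<theta> j\<close> at \<open>ix j\<close>, while less than
        \<open>n * \<theta> l\<close> lies outside the set at \<open>ix l\<close>.\<close>
      have "\<theta> j * val (S l) (ix l - ix j) q \<le> D (ix j) q * val (S l) (ix l - ix j) q"
        using that unfolding jl(3)[symmetric] by (intro mult_right_mono val_nonneg) (simp add: S_def)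
      also have "\<dots> \<le> mass (D (ix l)) (- S l)"
        using val_le[of "ix j" q "ix l - ix j"] ix_less[OF jl(1,2)] by simp
      also have "\<dots> < real n * \<theta> l" using jl by (intro outside)
      also have "\<dots> \<le> real n * \<theta> (Suc j)" using jl by (intro mult_left_mono \<theta>_antimono) auto
      also have "\<dots> = \<theta> j * g" by (rule \<theta>_Suc)
      finally show ?thesis using \<theta>_pos by (simp add: g_def assms(1))
    qed
    show "val (S l) (ix j) q < \<alpha> ^ (CARD('q) * 2 ^ CARD('q) + CARD('q) + 1)"
      if "q \<in> set_pmf d\<^sub>0" for q
    proof -
      \<comment> \<open>The same comparison from instant 0, where every initial state weighs at
        least \<open>\<alpha>\<^sub>0\<close>.\<close>
      have "\<alpha>\<^sub>0 * val (S l) (ix j) q \<le> D 0 q * val (S l) (ix j) q"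
        unfolding assms(3) D_def state_dist_0 using that
        by (intro mult_right_mono val_nonneg min_init_prob)
      also have "\<dots> \<le> mass (D (ix j)) (- S j)" using val_le[of 0 q "ix j"] jl by simp
      also have "\<dots> < real n * \<theta> j" using jl by (intro outside) simp
      also have "\<dots> \<le> real n * \<theta> 0" by (intro mult_left_mono \<theta>_antimono) auto
      also have "\<dots> = \<alpha>\<^sub>0 * g" by (rule \<theta>_0)
      finally show ?thesis using \<alpha>\<^sub>0 by (simp add: g_def assms(1))
    qed
  qed
  then obtain \<sigma>' where
    \<sigma>': "\<And>\<epsilon>. 0 < \<epsilon> \<Longrightarrow> \<exists>\<^sub>\<infinity>i. 1 - \<epsilon> \<le> mass (state_dist \<delta> \<sigma>' d\<^sub>0 i) (S l)"
    unfolding almost_sure_weakly_sync_def by blast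
  have mass_mono: "mass (state_dist \<delta> \<sigma>' d\<^sub>0 i) (S l) \<le> mass (state_dist \<delta> \<sigma>' d\<^sub>0 i) T" for i
    unfolding mass_def by (intro sum_mono2) (auto simp: S_def state_dist_nonneg)
  have "\<exists>\<^sub>\<infinity>i. 1 - \<epsilon> \<le> mass (state_dist \<delta> \<sigma>' d\<^sub>0 i) T" if "0 < \<epsilon>" for \<epsilon>
    by (rule INFM_mono[OF \<sigma>'[OF that]]) (rule order_trans[OF _ mass_mono])
  then have "almost_sure_weakly_sync \<delta> d\<^sub>0 T"
    unfolding almost_sure_weakly_sync_def by blast
  with assms(6) show False by contradiction
qed

end
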